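(* Let $\lambda\in\mathbb{R}$, and let $f:\mathbb{P}\to\mathbb{R}$ and $g:\mathbb{N}\to\mathbb{R}$ be functions with $g(0)=1$. Define $h:\mathbb{N}\to\mathbb{R}$ by $h(0)=1$ and, for $n>0$, $$h(n)=\sum_{\substack{\{B_1,\dots,B_k\}\in\Pi'([n])\\ k\ge 1}}\lambda^{\#B_1+\cdots+\#B_k-\#(B_1\cup\cdots\cup B_k)}f(\#B_1)\cdots f(\#B_k)\,g(k),$$ where the sum ranges over all generalized partitions $\{B_1,\dots,B_k\}$ of $[n]$ (with any number $k\geq 1$ of blocks). Then $$E_{\lambda,h}=E_{\lambda,g}(E_{\lambda,f})\quad\text{in }\widehat{\mathrm{Sh}}_\lambda(\mathbb{R}),$$ where $E_{\lambda,f}=\sum_{n\ge 1}f(n)\mathbf{1}_n$.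
   Context: $\mathbb{N}=\{0,1,2,\dots\}$, $\mathbb{P}=\{1,2,\dots\}$, $[n]=\{1,\dots,n\}$; $\#Y$ is the cardinality of $Y$; $\lambda^0=1$ (also for $\lambda=0$). For $\lambda\in\mathbb{R}$, $\widehat{\mathrm{Sh}}_\lambda(\mathbb{R})=\prod_{k\ge 0}\mathbb{R}\,\mathbf{1}_k$ is the commutative $\mathbb{R}$-algebra of all formal infinite sums $\sum_{k\ge 0}a_k\mathbf{1}_k$, with product $\diamond$ given on basis elements by $$\mathbf{1}_m\diamond\mathbf{1}_n=\sum_{i=0}^{\min(m,n)}\lambda^i\binom{m+n-i}{m}\binom{m}{i}\mathbf{1}_{m+n-i}$$ and extended to infinite sums by distributivity (each $\mathbf{1}_u$ receives finitely many contributions). The unit is $\mathbf{1}_0=1$. For $g:\mathbb{N}\to\mathbb{R}$ put $E_{\lambda,g}=\sum_{n\ge0}g(n)\mathbf{1}_n$; for $f:\mathbb{P}\to\mathbb{R}$ put $E_{\lambda,f}=\sum_{n\ge1}f(n)\mathbf{1}_n$. Operators: $d_A(\sum_{n\ge0}a_n\mathbf{1}_n)=\sum_{n\ge0}a_{n+1}\mathbf{1}_n$ and $P_A(\sum_{n\ge0}a_n\mathbf{1}_n)=\sum_{n\ge1}a_{n-1}\mathbf{1}_n$. Divided powers: $E_{\lambda,f^{[0]}}=1$ and $E_{\lambda,f^{[n]}}=P_A\big(E_{\lambda,f^{[n-1]}}\diamond d_A(E_{\lambda,f})\big)$ for $n\ge1$. Composition: for $f:\mathbb{P}\to\mathbb{R}$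 and $g:\mathbb{N}\to\mathbb{R}$, $E_{\lambda,g}(E_{\lambda,f})=\sum_{k\ge0}g(k)E_{\lambda,f^{[k]}}$ (the coefficient of each $\mathbf{1}_n$ is a finite sum, because $E_{\lambda,f^{[k]}}$ involves only $\mathbf{1}_n$ with $n\ge k$). A generalized partition (with distinct max) of $[n]$ is a collection $\{B_1,\dots,B_k\}$ of nonempty subsets of $[n]$ with $B_1\cup\cdots\cup B_k=[n]$ and $\max B_1<\max B_2<\cdots<\max B_k$ (blocks may overlap). $\Pi'([n])$ is the set of generalized partitions of $[n]$. *)

theory Defs
  imports Complex_Main
begin

text \<open>
  An element \<open>\<Sum>k\<ge>0. a k * 1_k\<close> of the completed shuffle algebra of weight \<open>\<lambda>\<close> over the reals
  is represented by its coefficient sequence \<open>a\<close>; the weight enters through the product only.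
\<close>

type_synonym sh = "nat \<Rightarrow> real"

definition sh_basis :: "nat \<Rightarrow> sh" where
  "sh_basis k = (\<lambda>u. if u = k then 1 else 0)"

definition sh_basis_mult :: "real \<Rightarrow> nat \<Rightarrow> nat \<Rightarrow> sh" where
  "sh_basis_mult lam m n = (\<lambda>u. \<Sum>i=0..min m n.
     lam ^ i * real ((m + n - i) choose m) * real (m choose i) * sh_basis (m + n - i) u)"

lemma sh_basis_mult_eq_0: "u < m \<or> u < n \<Longrightarrow> sh_basis_mult lam m n u = 0"
  by (auto simp: sh_basis_mult_def sh_basis_def intro!: sum.neutral)

text \<open>
  The product of \<open>1_m\<close> and \<open>1_n\<close> contributes to \<open>1_u\<close> only if \<open>m \<le> u\<close> and \<open>n \<le> u\<close>
  (\<open>sh_basis_mult_eq_0\<close>), so the infinite distributive law reduces to the following finite sum.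
\<close>

definition sh_mult :: "real \<Rightarrow> sh \<Rightarrow> sh \<Rightarrow> sh" where
  "sh_mult lam a b = (\<lambda>u. \<Sum>m\<le>u. \<Sum>n\<le>u. a m * b n * sh_basis_mult lam m n u)"

definition sh_d :: "sh \<Rightarrow> sh" where
  "sh_d a = (\<lambda>n. a (Suc n))"

definition sh_P :: "sh \<Rightarrow> sh" where
  "sh_P a = (\<lambda>n. if n = 0 then 0 else a (n - 1))"

definition sh_E :: "(nat \<Rightarrow> real) \<Rightarrow> sh" where
  "sh_E g = (\<lambda>n. g n)"

text \<open>
  A function on the positive integers is represented by a function on \<open>nat\<close> whose value at \<open>0\<close>
  is never used.
\<close>

definition sh_E_pos :: "(nat \<Rightarrow> real) \<Rightarrow> sh" where
  "sh_E_pos f = (\<lambda>n. if n = 0 then 0 else f n)"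

primrec sh_divpow :: "real \<Rightarrow> (nat \<Rightarrow> real) \<Rightarrow> nat \<Rightarrow> sh" where
  "sh_divpow lam f 0 = sh_basis 0"
| "sh_divpow lam f (Suc n) = sh_P (sh_mult lam (sh_divpow lam f n) (sh_d (sh_E_pos f)))"

lemma sh_divpow_eq_0: "n < k \<Longrightarrow> sh_divpow lam f k n = 0"
proof (induction k arbitrary: n)
  case (Suc k)
  then show ?case
    by (cases n) (auto simp: sh_P_def sh_mult_def intro!: sum.neutral)
qed simp

text \<open>
  By \<open>sh_divpow_eq_0\<close>, only the summands with \<open>k \<le> n\<close> of the composition
  \<open>\<Sum>k\<ge>0. g k * f^[k]\<close> contribute to its \<open>n\<close>-th coefficient.
\<close>

definition sh_comp :: "real \<Rightarrow> (nat \<Rightarrow> real) \<Rightarrow> (nat \<Rightarrow> real) \<Rightarrow> sh" where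
  "sh_comp lam g f = (\<lambda>n. \<Sum>k\<le>n. g k * sh_divpow lam f k n)"

text \<open>
  A generalized partition is an unordered collection of blocks; the list below is its enumeration
  by strictly increasing maxima.
\<close>

definition gen_partitions :: "nat set \<Rightarrow> nat set set set" where
  "gen_partitions A = {\<pi>. (\<forall>B\<in>\<pi>. B \<noteq> {} \<and> B \<subseteq> A) \<and> \<Union>\<pi> = A \<and>
     (\<exists>Bs. set Bs = \<pi> \<and> sorted_wrt (\<lambda>B C. Max B < Max C) Bs)}"

end

theory Submission
  imports Defs
begin

text \<open>
  If \<open>S \<union> T = V\<close> with \<open>card V = u\<close>, \<open>card S = m\<close>, \<open>card T = n\<close>, then \<open>card (S \<inter> T) = m + n - u\<close>, and there are
  \<open>(u choose m) * (m choose (m + n - u))\<close> such pairs; so the coefficient of \<open>1_u\<close> in the product of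
  \<open>1_m\<close> and \<open>1_n\<close> counts coverings of a \<open>u\<close>-set by two subsets, weighted by \<open>\<lambda>\<close> to the power of the overlap.
  In a generalized partition of \<open>A\<close> exactly one block contains \<open>a = Max A\<close>. Writing it as
  \<open>insert a T\<close>, the other blocks form a generalized partition of some \<open>S\<close> with
  \<open>S \<union> T = A - {a}\<close>, and the overlap exponents add up. This is the recursion of the divided powers, and
  by induction on \<open>k\<close> the weighted sum over the generalized partitions of \<open>A\<close> with \<open>k\<close> blocks
  is the coefficient of \<open>1_(card A)\<close> in the \<open>k\<close>-th divided power.
\<close>

section \<open>Products of basis elements as weighted counts of coverings\<close>

text \<open>Only the summand with \<open>i = m + n - u\<close> contributes to index
  \<open>u\<close>; the two hypotheses keep this \<open>i\<close> at most
  \<open>min m n\<close>.\<close>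

lemma sh_basis_mult_eq:
  assumes "m \<le> u" "n \<le> u"
  shows "sh_basis_mult lam m n u =
    (if u \<le> m + n then lam ^ (m + n - u) * real ((u choose m) * (m choose (m + n - u))) else 0)"
proof (cases "u \<le> m + n")
  case True
  have "sh_basis_mult lam m n u = (\<Sum>i=0..min m n. if i = m + n - u then
      lam ^ (m + n - u) * real ((u choose m) * (m choose (m + n - u))) else 0)"
    unfolding sh_basis_mult_def sh_basis_def using True assms
    by (intro sum.cong) auto
  also have "\<dots> = lam ^ (m + n - u) * real ((u choose m) * (m choose (m + n - u)))"
    using assms True by (simp add: sum.delta) linarith
  finally show ?thesis using True by simp
next
  case False
  then show ?thesis
    by (auto simp: sh_basis_mult_def sh_basis_def intro!: sum.neutral)
qed

text \<open>\<open>T\<close> must contain \<open>V - S\<close> and is free on \<open>S\<close>, so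
  it is determined by \<open>S \<inter> T\<close>, a subset of \<open>S\<close> of size
  \<open>n - card (V - S)\<close>.\<close>

lemma card_coverings_fixed_left:
  assumes "finite V" "S \<subseteq> V"
  shows "card {T. S \<union> T = V \<and> card T = n} =
    (if card V \<le> card S + n then card S choose (card S + n - card V) else 0)"
proof -
  have fin: "finite S" "finite (V - S)"
    using assms finite_subset by auto
  have card_V: "card V = card S + card (V - S)"
    using assms fin by (metis Diff_disjoint Un_Diff_cancel card_Un_disjoint sup.absorb_iff2)
  have card_split: "card ((V - S) \<union> U) = card (V - S) + card U" if "U \<subseteq> S" for U
    using that fin finite_subset by (intro card_Un_disjoint) auto
  have T_split: "T = (V - S) \<union> (S \<inter> T)" if "S \<union> T = V" for T
    using that by auto
  show ?thesis
  proof (cases "card V \<le> card S + n")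
    case True
    have "bij_betw (\<lambda>T. S \<inter> T) {T. S \<union> T = V \<and> card T = n}
        {U. U \<subseteq> S \<and> card U = card S + n - card V}"
    proof (rule bij_betw_byWitness[where f' = "\<lambda>U. (V - S) \<union> U"])
      show "(\<lambda>T. S \<inter> T) ` {T. S \<union> T = V \<and> card T = n}
          \<subseteq> {U. U \<subseteq> S \<and> card U = card S + n - card V}"
      proof clarify
        fix T assume "V = S \<union> T" "n = card T"
        then have "n = card (V - S) + card (S \<inter> T)"
          using T_split card_split[of "S \<inter> T"] by (metis inf_le1)
        then show "S \<inter> T \<subseteq> S \<and> card (S \<inter> T) = card S + card T - card (S \<union> T)"
          using card_V \<open>n = card T\<close> \<open>V = S \<union> T\<close> by auto
      qed
      show "(\<lambda>U. (V - S) \<union> U) ` {U. U \<subseteq> S \<and> card U = card S + n - card V}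
          \<subseteq> {T. S \<union> T = V \<and> card T = n}"
        using assms True card_V card_split by auto
    qed auto
    then have "card {T. S \<union> T = V \<and> card T = n} =
        card {U. U \<subseteq> S \<and> card U = card S + n - card V}"
      by (rule bij_betw_same_card)
    then show ?thesis
      using True n_subsets[OF fin(1)] by simp
  next
    case False
    then have "{T. S \<union> T = V \<and> card T = n} = {}"
      using card_Un_le[of S] by fastforce
    with False show ?thesis by (simp only: card.empty if_False)
  qed
qed

text \<open>Choosing \<open>S\<close> first and then \<open>T\<close> counts the pairs, and all of
  them carry the same power of \<open>lam\<close>.\<close>

lemma sum_coverings_fixed_card:
  assumes "finite V" "m \<le> card V" "n \<le> card V"
  shows "(\<Sum>(S, T) | S \<union> T = V \<and> card S = m \<and> card T = n. lam ^ (card S + card T - card V))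
    = sh_basis_mult lam m n (card V)"
proof -
  have "{(S, T). S \<union> T = V \<and> card S = m \<and> card T = n} =
      (SIGMA S:{S. S \<subseteq> V \<and> card S = m}. {T. S \<union> T = V \<and> card T = n})"
    by auto
  moreover have "finite {S. S \<subseteq> V \<and> card S = m}" "finite {T. S \<union> T = V \<and> card T = n}" for S
    using assms(1) by (auto intro: finite_subset[of _ "Pow V"])
  ultimately have "card {(S, T). S \<union> T = V \<and> card S = m \<and> card T = n} =
      (\<Sum>S | S \<subseteq> V \<and> card S = m. card {T. S \<union> T = V \<and> card T = n})"
    by simp
  also have "\<dots> = (\<Sum>S | S \<subseteq> V \<and> card S = m.
      if card V \<le> m + n then m choose (m + n - card V) else 0)"
    using card_coverings_fixed_left[OF assms(1)] by (intro sum.cong) auto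
  also have "\<dots> = (card V choose m) * (if card V \<le> m + n then m choose (m + n - card V) else 0)"
    using n_subsets[OF assms(1)] by simp
  finally have count: "card {(S, T). S \<union> T = V \<and> card S = m \<and> card T = n} =
    (card V choose m) * (if card V \<le> m + n then m choose (m + n - card V) else 0)" .
  have "(\<Sum>(S, T) | S \<union> T = V \<and> card S = m \<and> card T = n. lam ^ (card S + card T - card V))
    = (\<Sum>(S, T) | S \<union> T = V \<and> card S = m \<and> card T = n. lam ^ (m + n - card V))"
    by (intro sum.cong) auto
  then show ?thesis
    using count assms by (simp add: sh_basis_mult_eq case_prod_unfold)
qed

text \<open>Grouping the coverings by \<open>(card S, card T)\<close> gives the double sum that
  defines the product.\<close>

lemma sh_mult_eq_sum_coverings:
  assumes "finite V"
  shows "sh_mult lam a b (card V) =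
    (\<Sum>(S, T) | S \<union> T = V. a (card S) * b (card T) * lam ^ (card S + card T - card V))"
proof -
  let ?C = "{(S, T). S \<union> T = V}" and ?K = "{..card V}"
  let ?F = "\<lambda>(S, T). a (card S) * b (card T) * lam ^ (card S + card T - card V)"
  have fin: "finite ?C"
    using assms by (intro finite_subset[of ?C "Pow V \<times> Pow V"]) auto
  have le: "(\<lambda>(S, T). (card S, card T)) ` ?C \<subseteq> ?K \<times> ?K"
    using assms by (auto intro!: card_mono)
  have "sum ?F ?C = (\<Sum>(m, n)\<in>?K \<times> ?K. sum ?F {p \<in> ?C. (\<lambda>(S, T). (card S, card T)) p = (m, n)})"
    using sum.group[OF fin _ le, of ?F] by (simp add: case_prod_unfold prod_eq_iff)
  also have "\<dots> = (\<Sum>(m, n)\<in>?K \<times> ?K. a m * b n * sh_basis_mult lam m n (card V))"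
  proof (intro sum.cong refl, unfold split_paired_all split_conv)
    fix m n assume "(m, n) \<in> ?K \<times> ?K"
    then have mn: "m \<in> ?K" "n \<in> ?K" by auto
    have "{p \<in> ?C. (\<lambda>(S, T). (card S, card T)) p = (m, n)} =
        {(S, T). S \<union> T = V \<and> card S = m \<and> card T = n}"
      by auto
    moreover have "sum ?F {(S, T). S \<union> T = V \<and> card S = m \<and> card T = n} =
        a m * b n * (\<Sum>(S, T) | S \<union> T = V \<and> card S = m \<and> card T = n.
          lam ^ (card S + card T - card V))"
      unfolding sum_distrib_left by (intro sum.cong) auto
    ultimately show "sum ?F {p \<in> ?C. (\<lambda>(S, T). (card S, card T)) p = (m, n)} =
        a m * b n * sh_basis_mult lam m n (card V)"
      using sum_coverings_fixed_card[OF assms] mn by simp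
  qed
  finally show ?thesis
    by (simp add: sh_mult_def sum.cartesian_product)
qed

section \<open>Generalized partitions described without an enumeration\<close>

text \<open>Finitely many blocks can be listed by increasing maxima exactly when their maxima are
  distinct. Injectivity of \<open>Max\<close> is easier to carry through insertion and removal of a
  block than a list.\<close>

lemma gen_partitions_iff:
  assumes "finite A"
  shows "\<pi> \<in> gen_partitions A \<longleftrightarrow> {} \<notin> \<pi> \<and> \<Union>\<pi> = A \<and> inj_on Max \<pi>"
proof
  assume "\<pi> \<in> gen_partitions A"
  then obtain Bs where Bs: "set Bs = \<pi>" "sorted_wrt (\<lambda>B C. Max B < Max C) Bs"
    and *: "{} \<notin> \<pi>" "\<Union>\<pi> = A"
    by (auto simp: gen_partitions_def)
  have "inj_on Max (set Bs)"
    using Bs(2)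
  proof (induction Bs)
    case (Cons B Bs)
    then have "Max B \<notin> Max ` set Bs"
      by fastforce
    with Cons show ?case by (auto simp: inj_on_insert)
  qed simp
  with Bs * show "{} \<notin> \<pi> \<and> \<Union>\<pi> = A \<and> inj_on Max \<pi>" by simp
next
  assume *: "{} \<notin> \<pi> \<and> \<Union>\<pi> = A \<and> inj_on Max \<pi>"
  then have "finite \<pi>"
    using assms finite_UnionD by auto
  define ms where "ms = sorted_list_of_set (Max ` \<pi>)"
  \<comment> \<open>Each maximum, in increasing order, is sent back to its block.\<close>
  define Bs where "Bs = map (inv_into \<pi> Max) ms"
  have ms: "set ms = Max ` \<pi>" "sorted_wrt (<) ms"
    using \<open>finite \<pi>\<close> by (auto simp: ms_def)
  have "set Bs = \<pi>"
    using * ms by (force simp: Bs_def image_image)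
  moreover have "sorted_wrt (\<lambda>B C. Max B < Max C) Bs"
    unfolding Bs_def sorted_wrt_map
    by (rule sorted_wrt_mono_rel[OF _ ms(2)]) (simp add: ms f_inv_into_f)
  ultimately show "\<pi> \<in> gen_partitions A"
    using * unfolding gen_partitions_def by blast
qed

lemma finite_gen_partition:
  assumes "finite A" "\<pi> \<in> gen_partitions A"
  shows "finite \<pi>"
  using assms finite_UnionD by (auto simp: gen_partitions_iff)

lemma finite_gen_partitions:
  assumes "finite A"
  shows "finite (gen_partitions A)"
  by (rule finite_subset[of _ "Pow (Pow A)"]) (use assms in \<open>auto simp: gen_partitions_def\<close>)

text \<open>\<open>Max\<close> embeds the blocks into \<open>A\<close>.\<close>

lemma card_gen_partition_le:
  assumes "finite A" "\<pi> \<in> gen_partitions A"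
  shows "card \<pi> \<le> card A"
proof (rule card_inj_on_le)
  show "inj_on Max \<pi>" "finite A"
    using assms by (auto simp: gen_partitions_iff)
  have "Max B \<in> B" if "B \<in> \<pi>" for B
    using assms that by (intro Max_in) (auto simp: gen_partitions_iff intro: finite_subset)
  then show "Max ` \<pi> \<subseteq> A"
    using assms by (auto simp: gen_partitions_iff)
qed

section \<open>Weights and the block containing the maximum\<close>

text \<open>The factor \<open>g (card \<pi>)\<close> is left out, as it is constant once the number
  of blocks is fixed.\<close>

definition gp_weight :: "real \<Rightarrow> (nat \<Rightarrow> real) \<Rightarrow> nat set set \<Rightarrow> real" where
  "gp_weight lam f \<pi> = lam ^ ((\<Sum>B\<in>\<pi>. card B) - card (\<Union>\<pi>)) * (\<Prod>B\<in>\<pi>. f (card B))"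

text \<open>The point \<open>a\<close> lies in the new block only, so it adds one both to the sum of
  the sizes and to the size of the union, and cancels. The exponent grows by the overlap of
  \<open>T\<close> with \<open>\<Union>\<pi>\<close>.\<close>

lemma gp_weight_insert:
  assumes "finite \<pi>" "finite T" "finite (\<Union>\<pi>)" "a \<notin> T" "a \<notin> \<Union>\<pi>"
  shows "gp_weight lam f (insert (insert a T) \<pi>) = gp_weight lam f \<pi> *
    (f (Suc (card T)) * lam ^ (card (\<Union>\<pi>) + card T - card (\<Union>\<pi> \<union> T)))"
proof -
  have notin: "insert a T \<notin> \<pi>"
    using assms by auto
  have "card (\<Union>(insert (insert a T) \<pi>)) = Suc (card (\<Union>\<pi> \<union> T))"
    using assms by (simp add: Un_commute)
  \<comment> \<open>This bound and the next make the truncated subtractions exact, so that the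
    exponents add up.\<close>
  moreover have "card (\<Union>\<pi>) \<le> (\<Sum>B\<in>\<pi>. card B)"
    using assms card_Union_le_sum_card[of \<pi>] finite_Union by blast
  moreover have "card (\<Union>\<pi> \<union> T) \<le> card (\<Union>\<pi>) + card T"
    by (rule card_Un_le)
  ultimately have "(\<Sum>B\<in>insert (insert a T) \<pi>. card B) - card (\<Union>(insert (insert a T) \<pi>)) =
      ((\<Sum>B\<in>\<pi>. card B) - card (\<Union>\<pi>)) + (card (\<Union>\<pi>) + card T - card (\<Union>\<pi> \<union> T))"
    using assms notin by simp
  then show ?thesis
    using assms notin by (simp only: gp_weight_def power_add) simp
qed

text \<open>The new block has maximum \<open>a\<close>, which exceeds every other maximum, so
  \<open>Max\<close> stays injective. \<open>T\<close> may be empty and may overlap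
  \<open>S\<close>.\<close>

lemma gen_partition_insert_max:
  assumes "finite S" "finite T" "\<pi> \<in> gen_partitions S" "\<And>x. x \<in> S \<union> T \<Longrightarrow> x < a"
  shows "insert (insert a T) \<pi> \<in> gen_partitions (insert a (S \<union> T))"
proof -
  have "Max (insert a T) = a"
    using assms by (intro Max_eqI) (auto intro: less_imp_le)
  moreover have "Max B < a" if "B \<in> \<pi>" for B
  proof -
    have "B \<noteq> {}" "B \<subseteq> S"
      using assms that by (auto simp: gen_partitions_def)
    then show ?thesis
      using assms finite_subset by (subst Max_less_iff) auto
  qed
  ultimately have "inj_on Max (insert (insert a T) \<pi>)"
    using assms by (fastforce simp: gen_partitions_iff)
  then show ?thesis
    using assms by (auto simp: gen_partitions_iff)
qed

text \<open>Two blocks containing \<open>Max A\<close> would share this maximum, so exactly one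
  contains it. \<open>T\<close> is the rest of that block, and \<open>S\<close> is the union of the
  other blocks.\<close>

lemma gen_partition_remove_max:
  assumes "finite A" "A \<noteq> {}" "\<pi> \<in> gen_partitions A"
  obtains S T \<pi>' where "S \<union> T = A - {Max A}" "\<pi>' \<in> gen_partitions S"
    "\<pi> = insert (insert (Max A) T) \<pi>'"
proof -
  define a where "a = Max A"
  have \<pi>: "{} \<notin> \<pi>" "\<Union>\<pi> = A" "inj_on Max \<pi>"
    using assms by (auto simp: gen_partitions_iff)
  have "a \<in> A"
    using assms by (simp add: a_def)
  then obtain B where B: "B \<in> \<pi>" "a \<in> B"
    using \<pi> by auto
  have Max_a: "Max C = a" if "C \<in> \<pi>" "a \<in> C" for C
  proof (rule Max_eqI)
    have "C \<subseteq> A"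
      using that \<pi> by auto
    then show "finite C" "\<And>y. y \<in> C \<Longrightarrow> y \<le> a"
      using assms(1) by (auto simp: a_def intro: finite_subset)
  qed (rule that)
  have uniq: "C = B" if "C \<in> \<pi>" "a \<in> C" for C
    using that B Max_a \<pi>(3) by (metis inj_onD)
  have notin: "a \<notin> \<Union>(\<pi> - {B})"
    using uniq by fast
  have "\<Union>(\<pi> - {B}) \<union> B = A"
    using \<pi>(2) B(1) by (metis Sup_insert insert_Diff sup_commute)
  then have un: "\<Union>(\<pi> - {B}) \<union> (B - {a}) = A - {a}"
    using notin by (metis Diff_insert_absorb Diff_empty Un_Diff Diff_insert0)
  show thesis
  proof
    show "\<Union>(\<pi> - {B}) \<union> (B - {a}) = A - {Max A}"
      using un by (simp only: a_def)
    show "\<pi> - {B} \<in> gen_partitions (\<Union>(\<pi> - {B}))"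
    proof (subst gen_partitions_iff)
      have "\<Union>(\<pi> - {B}) \<subseteq> A"
        using \<pi>(2) by blast
      then show "finite (\<Union>(\<pi> - {B}))"
        using assms(1) by (rule finite_subset)
      have "inj_on Max (\<pi> - {B})"
        using \<pi>(3) by (rule inj_on_subset) blast
      then show "{} \<notin> \<pi> - {B} \<and> \<Union>(\<pi> - {B}) = \<Union>(\<pi> - {B}) \<and> inj_on Max (\<pi> - {B})"
        using \<pi>(1) by simp
    qed
    show "\<pi> = insert (insert (Max A) (B - {a})) (\<pi> - {B})"
      using B by (auto simp: insert_absorb simp flip: a_def)
  qed
qed

lemma bij_betw_insert_max:
  assumes "finite A" "A \<noteq> {}"
  shows "bij_betw (\<lambda>((S, T), \<pi>). insert (insert (Max A) T) \<pi>)
    (SIGMA p:{(S, T). S \<union> T = A - {Max A}}. {\<pi> \<in> gen_partitions (fst p). card \<pi> = k})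
    {\<pi> \<in> gen_partitions A. card \<pi> = Suc k}"
proof -
  define a where "a = Max A"
  have a: "a \<in> A" "\<And>x. x \<in> A - {a} \<Longrightarrow> x < a"
    using assms by (auto simp: a_def le_neq_implies_less)
  have *: "finite S" "finite T" "a \<notin> S" "a \<notin> T" "a \<notin> \<Union>\<pi>" "insert a T \<notin> \<pi>" "\<Union>\<pi> = S"
      "finite \<pi>" "insert a (S \<union> T) = A"
    if "S \<union> T = A - {a}" "\<pi> \<in> gen_partitions S" for S T \<pi>
  proof -
    have "finite (S \<union> T)"
      using that assms by simp
    then show fin: "finite S" "finite T" by auto
    show un: "\<Union>\<pi> = S"
      using that fin by (simp add: gen_partitions_iff)
    show "finite \<pi>"
      using that fin finite_gen_partition by blast
    show "insert a (S \<union> T) = A" "a \<notin> S" "a \<notin> T"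
      using that a by auto
    then show "a \<notin> \<Union>\<pi>" "insert a T \<notin> \<pi>"
      using un by auto
  qed
  show ?thesis
    unfolding a_def[symmetric]
  proof (rule bij_betw_imageI)
    \<comment> \<open>The inverse separates the blocks by membership of \<open>a\<close>: those
      without \<open>a\<close> return \<open>\<pi>\<close> and, as their union, \<open>S\<close>;
      the only one with \<open>a\<close> returns \<open>T\<close>.\<close>
    show "inj_on (\<lambda>((S, T), \<pi>). insert (insert a T) \<pi>)
        (SIGMA p:{(S, T). S \<union> T = A - {a}}. {\<pi> \<in> gen_partitions (fst p). card \<pi> = k})"
    proof (rule inj_on_inverseI[where g = "\<lambda>\<pi>. ((\<Union>{B \<in> \<pi>. a \<notin> B}, \<Union>{B \<in> \<pi>. a \<in> B} - {a}),
          {B \<in> \<pi>. a \<notin> B})"], clarsimp)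
      fix S T \<pi> assume asm: "S \<union> T = A - {a}" "\<pi> \<in> gen_partitions S"
      note facts = *[OF asm]
      have "{B. (B = insert a T \<or> B \<in> \<pi>) \<and> a \<notin> B} = \<pi>"
        "{B. (B = insert a T \<or> B \<in> \<pi>) \<and> a \<in> B} = {insert a T}"
        using facts by auto
      then show "\<Union>{B. (B = insert a T \<or> B \<in> \<pi>) \<and> a \<notin> B} = S \<and>
          \<Union>{B. (B = insert a T \<or> B \<in> \<pi>) \<and> a \<in> B} - {a} = T \<and>
          {B. (B = insert a T \<or> B \<in> \<pi>) \<and> a \<notin> B} = \<pi>"
        using facts by auto
    qed
    show "(\<lambda>((S, T), \<pi>). insert (insert a T) \<pi>) `
        (SIGMA p:{(S, T). S \<union> T = A - {a}}. {\<pi> \<in> gen_partitions (fst p). card \<pi> = k})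
        = {\<pi> \<in> gen_partitions A. card \<pi> = Suc k}" (is "?F ` ?D = ?R")
    proof
      show "?F ` ?D \<subseteq> ?R"
      proof (rule image_subsetI, unfold split_paired_all split_conv)
        fix S T \<pi> assume "((S, T), \<pi>) \<in> ?D"
        then have asm: "S \<union> T = A - {a}" "\<pi> \<in> gen_partitions S" and k: "card \<pi> = k"
          by auto
        note facts = *[OF asm]
        have "insert (insert a T) \<pi> \<in> gen_partitions (insert a (S \<union> T))"
          using asm facts(1,2) a(2) by (intro gen_partition_insert_max) auto
        then show "insert (insert a T) \<pi> \<in> ?R"
          using facts(6,8,9) k by simp
      qed
      show "?R \<subseteq> ?F ` ?D"
      proof
        fix \<pi> assume "\<pi> \<in> ?R"
        then have \<pi>: "\<pi> \<in> gen_partitions A" "card \<pi> = Suc k" by auto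
        from gen_partition_remove_max[OF assms \<pi>(1)]
        obtain S T \<pi>' where asm: "S \<union> T = A - {a}" "\<pi>' \<in> gen_partitions S"
          and eq: "\<pi> = insert (insert a T) \<pi>'"
          unfolding a_def by metis
        note facts = *[OF asm]
        have "card \<pi>' = k"
          using \<pi>(2) facts(6,8) by (simp add: eq)
        then have "((S, T), \<pi>') \<in> ?D"
          using asm by simp
        then show "\<pi> \<in> ?F ` ?D"
          by (rule rev_image_eqI) (simp add: eq)
      qed
    qed
  qed
qed

section \<open>Divided powers as sums over generalized partitions\<close>

text \<open>Removing the block with the maximum mirrors the recursion of \<open>sh_divpow\<close>.
  The induction keeps \<open>A\<close> arbitrary because its hypothesis is applied to every
  \<open>S\<close> in a covering of \<open>A\<close> without its maximum.\<close>

lemma sum_gp_weight_eq_sh_divpow: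
  assumes "finite A"
  shows "(\<Sum>\<pi> | \<pi> \<in> gen_partitions A \<and> card \<pi> = k. gp_weight lam f \<pi>) = sh_divpow lam f k (card A)"
  using assms
proof (induction k arbitrary: A)
  case 0
  have iff: "\<pi> \<in> gen_partitions A \<and> card \<pi> = 0 \<longleftrightarrow> A = {} \<and> \<pi> = {}" for \<pi>
  proof
    assume "\<pi> \<in> gen_partitions A \<and> card \<pi> = 0"
    moreover from this have "\<pi> = {}"
      using finite_gen_partition[OF 0, of \<pi>] by simp
    ultimately show "A = {} \<and> \<pi> = {}"
      by (simp add: gen_partitions_iff[OF 0])
  qed (use 0 in \<open>simp add: gen_partitions_iff\<close>)
  show ?case
    unfolding iff using 0 by (cases "A = {}") (simp_all add: gp_weight_def sh_basis_def)
next
  case (Suc k)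
  show ?case
  proof (cases "A = {}")
    case True
    \<comment> \<open>The empty set admits no blocks, in agreement with the coefficient 0 that
      \<open>sh_P\<close> puts at index 0.\<close>
    have "{\<pi> \<in> gen_partitions A. card \<pi> = Suc k} = {}"
      using card_gen_partition_le[OF Suc.prems] True by fastforce
    with True show ?thesis
      by (simp only: sum.empty) (simp add: sh_P_def)
  next
    case False
    define a where "a = Max A"
    define V where "V = A - {a}"
    have V: "finite V" "card A = Suc (card V)" "a \<notin> V"
      using Suc.prems False card.remove[of A a] by (simp_all add: V_def a_def)
    let ?C = "{(S, T). S \<union> T = V}"
    let ?G = "\<lambda>S. {\<pi> \<in> gen_partitions S. card \<pi> = k}"
    have fin: "finite ?C"
      using V by (intro finite_subset[of ?C "Pow V \<times> Pow V"]) auto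
    have finG: "finite (?G (fst p))" if "p \<in> ?C" for p
    proof -
      have "finite (fst p \<union> snd p)"
        using that V(1) by auto
      then show ?thesis
        using finite_gen_partitions by simp
    qed
    have "(\<Sum>\<pi> | \<pi> \<in> gen_partitions A \<and> card \<pi> = Suc k. gp_weight lam f \<pi>) =
        (\<Sum>((S, T), \<pi>)\<in>(SIGMA p:?C. ?G (fst p)). gp_weight lam f (insert (insert a T) \<pi>))"
      unfolding a_def V_def
      by (subst sum.reindex_bij_betw[OF bij_betw_insert_max[OF Suc.prems False], symmetric])
        (simp add: case_prod_unfold)
    also have "\<dots> = (\<Sum>p\<in>?C. \<Sum>\<pi>\<in>?G (fst p). gp_weight lam f (insert (insert a (snd p)) \<pi>))"
      using fin finG by (subst sum.Sigma) (auto simp: case_prod_unfold)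
    \<comment> \<open>The shift by \<open>sh_d\<close> accounts for \<open>a\<close> in the new
      block: \<open>insert a T\<close> has size \<open>Suc (card T)\<close>, so \<open>f\<close> is
      read at a positive argument.\<close>
    also have "\<dots> = (\<Sum>(S, T)\<in>?C. sh_divpow lam f k (card S) * sh_d (sh_E_pos f) (card T) *
        lam ^ (card S + card T - card V))"
    proof (intro sum.cong refl, clarsimp)
      fix S T assume V_eq: "V = S \<union> T"
      then have ST: "finite S" "finite T" "a \<notin> S" "a \<notin> T"
        using V by auto
      have "gp_weight lam f (insert (insert a T) \<pi>) =
          gp_weight lam f \<pi> * (f (Suc (card T)) * lam ^ (card S + card T - card V))"
        if "\<pi> \<in> gen_partitions S" for \<pi>
      proof -
        have "\<Union>\<pi> = S" "finite \<pi>"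
          using that ST finite_gen_partition by (auto simp: gen_partitions_iff)
        then show ?thesis
          using gp_weight_insert[of \<pi> T a lam f] ST V_eq by simp
      qed
      then have "(\<Sum>\<pi>\<in>?G S. gp_weight lam f (insert (insert a T) \<pi>)) =
          (\<Sum>\<pi>\<in>?G S. gp_weight lam f \<pi>) * (f (Suc (card T)) * lam ^ (card S + card T - card V))"
        by (simp add: sum_distrib_right)
      then show "(\<Sum>\<pi>\<in>?G S. gp_weight lam f (insert (insert a T) \<pi>)) =
          sh_divpow lam f k (card S) * sh_d (sh_E_pos f) (card T) *
          lam ^ (card S + card T - card (S \<union> T))"
        using Suc.IH[OF ST(1)] V_eq by (simp add: sh_d_def sh_E_pos_def)
    qed
    also have "\<dots> = sh_mult lam (sh_divpow lam f k) (sh_d (sh_E_pos f)) (card V)"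
      using sh_mult_eq_sum_coverings[OF V(1)] by simp
    \<comment> \<open>The shift by \<open>sh_P\<close> accounts for \<open>a\<close> in the whole
      set: \<open>card A = Suc (card V)\<close>.\<close>
    also have "\<dots> = sh_divpow lam f (Suc k) (card A)"
      using V by (simp add: sh_P_def)
    finally show ?thesis .
  qed
qed

section \<open>Composition, grouped by the number of blocks\<close>

theorem theorem3p21:
  fixes lam :: real and f g h :: "nat \<Rightarrow> real"
  assumes g0: "g 0 = 1"
    and h0: "h 0 = 1"
    and hn: "\<And>n. n > 0 \<Longrightarrow>
      h n = (\<Sum>\<pi> | \<pi> \<in> gen_partitions {1..n} \<and> card \<pi> \<ge> 1.
        lam ^ ((\<Sum>B\<in>\<pi>. card B) - card (\<Union>\<pi>)) * (\<Prod>B\<in>\<pi>. f (card B)) * g (card \<pi>))"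
  shows "sh_E h = sh_comp lam g f"
proof
  fix n
  show "sh_E h n = sh_comp lam g f n"
  proof (cases "n = 0")
    case True
    then show ?thesis
      using g0 h0 by (simp add: sh_E_def sh_comp_def sh_basis_def)
  next
    case False
    let ?GP = "gen_partitions {1..n}"
    \<comment> \<open>For positive \<open>n\<close> the empty collection does not cover
      \<open>{1..n}\<close>, so the sum in \<open>hn\<close> runs over all of
      \<open>?GP\<close>.\<close>
    have "card \<pi> \<noteq> 0" if "\<pi> \<in> ?GP" for \<pi>
      using that False finite_gen_partition[of "{1..n}" \<pi>] by (auto simp: gen_partitions_iff)
    then have "{\<pi>. \<pi> \<in> ?GP \<and> card \<pi> \<ge> 1} = ?GP"
      by (auto simp: Suc_le_eq)
    then have "sh_E h n = (\<Sum>\<pi>\<in>?GP. g (card \<pi>) * gp_weight lam f \<pi>)"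
      using hn False by (simp add: sh_E_def gp_weight_def mult_ac)
    \<comment> \<open>There are at most \<open>n\<close> blocks, which is the cutoff for
      \<open>k\<close> in \<open>sh_comp\<close>.\<close>
    also have "\<dots> = (\<Sum>k\<le>n. \<Sum>\<pi> | \<pi> \<in> ?GP \<and> card \<pi> = k. g (card \<pi>) * gp_weight lam f \<pi>)"
      using card_gen_partition_le[of "{1..n}"]
      by (intro sum.group[symmetric] finite_gen_partitions) auto
    also have "\<dots> = (\<Sum>k\<le>n. g k * (\<Sum>\<pi> | \<pi> \<in> ?GP \<and> card \<pi> = k. gp_weight lam f \<pi>))"
      by (simp add: sum_distrib_left)
    also have "\<dots> = sh_comp lam g f n"
      by (simp add: sum_gp_weight_eq_sh_divpow sh_comp_def)
    finally show ?thesis .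
  qed
qed

end
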